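(* Let $\mathsf{A}$ be a recursively axiomatizable, sufficiently strong arithmetic theory in the signature $\langle 0,S,+,\times\rangle$, with provability predicate $\mathsf{Prov}_{\mathsf{A}}$, and let $\mathsf{Con}(\mathsf{A}):=\neg\mathsf{Prov}_{\mathsf{A}}(\ulcorner\bot\urcorner)$. Then $$\mathsf{A}\Vdash\mathsf{Con}(\mathsf{A}).$$
   Context: **Language.** First-order language over the finite signature $\langle 0,S,+,\times\rangle$, whose only constant is $0$ and whose atomic formulas are $t_1=t_2$; $=$ is treated as an ordinary binary predicate symbol, so the equality axioms used in derivations belong to the theory. Primitive logical constants: $\to,\land,\forall,\bot$ ($\bot$ is not an atomic formula). Abbreviations: $\neg\varphi:=\varphi\to\bot$, $\varphi\lor\psi:=\neg(\neg\varphi\land\neg\psi)$, $\exists x\,\varphi:=\neg\forall x\,\neg\varphi$. Numerals: $\bar 0=0$, $\overline{n}=S(\overline{n-1})$. $t<s$ abbreviates $\exists x(t+S(x)=s)$, and $\forall x<t\,\varphi$ abbreviates $\forall x(\exists y(x+S(y)=t)\to\varphi)$. A formula is $\Delta_0$ if all its quantifiers are bounded. **Bases.** An atomic rule is an inference figure with finitely many (possibly zero) premises $P_1,\dots,P_n$ and a conclusion $C$, all closed atomic formulas. A base $\mathfrak{B}$ is a set of atomic rules. $\vdash_{\mathfrak{B}} C$ means that there is a finite derivation tree with root $C$ built from rules of $\mathfrak{B}$: a premise-free rule with conclusion $C$ gives a derivation of $C$; if the rule from $P_1,\dots,P_n$ to $C$ is in $\mathfrak{B}$ and each $P_i$ has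 a $\mathfrak{B}$-derivation, these combine to a derivation of $C$. **Support.** For bases $\mathfrak{B},\mathfrak{C}$, closed formulas, and non-empty sets $\Delta$ of closed formulas: - $\Vdash_{\mathfrak{B}} P$ iff $\vdash_{\mathfrak{B}} P$, for $P$ a closed atom; - $\Vdash_{\mathfrak{B}}\varphi\land\psi$ iff $\Vdash_{\mathfrak{B}}\varphi$ and $\Vdash_{\mathfrak{B}}\psi$; - $\Vdash_{\mathfrak{B}}\varphi\to\psi$ iff $\varphi\Vdash_{\mathfrak{B}}\psi$; - $\Vdash_{\mathfrak{B}}\forall x\varphi$ iff $\Vdash_{\mathfrak{B}}\varphi[x\mapsto t]$ for all closed terms $t$; - $\Vdash_{\mathfrak{B}}\bot$ iff $\Vdash_{\mathfrak{B}}P$ for every closed atom $P$; - $\Delta\Vdash_{\mathfrak{B}}\varphi$ iff for all bases $\mathfrak{C}\supseteq\mathfrak{B}$, if $\Vdash_{\mathfrak{C}}\psi$ for all $\psi\in\Delta$, then $\Vdash_{\mathfrak{C}}\varphi$. **Validity.** For a set $\Gamma$ of closed formulas, $\Gamma\Vdash\varphi$ iff $\Gamma\Vdash_{\varnothing}\varphi$, where $\varnothing$ is the empty base. A theory $\mathsf{A}$ is identified with its set of axioms. **Theories.** $\vdash_{\mathsf{A}}\varphi$ means that $\varphi$ is derivable from the axioms of $\mathsf{A}$ in classical first-order logic. $\mathsf{A}$ is sufficiently strong if (i) for all $m,n\in\mathbb{N}$, $\vdash_{\mathsf{A}}\bar m=\bar n$ iff $m=n$; and (ii) for every $\Delta_0$-sentence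 $\delta$, $\vdash_{\mathsf{A}}\delta$ or $\vdash_{\mathsf{A}}\neg\delta$. $\mathsf{A}$ is recursively axiomatizable if there is a primitive recursive function enumerating its axioms. **Provability predicate.** Derivations are finite sequences of formulas in a calculus with rules modus ponens and universal generalization (generalization without side conditions, or with them built into $\mathsf{Gen}$); the logical axioms of the calculus are counted among the axioms of $\mathsf{A}$. Fix an effective Gödel numbering $\ulcorner\cdot\urcorner$ and $\Delta_0$-formulas $\mathsf{Form}(x)$ ($x$ codes a formula), $\mathsf{Seq}(p,n)$ ($p$ codes a finite sequence of length $n$), $\mathsf{Elt}(p,i,y)$ ($y$ is the $i$-th element of the sequence coded by $p$, indexing from $0$), $\mathsf{Ax}_{\mathsf{A}}(x)$ ($x$ codes an axiom of $\mathsf{A}$), $\mathsf{MP}(a,b,c)$ ($c$ follows from $a$ and $b$ by modus ponens), $\mathsf{Gen}(a,c)$ ($c$ follows from $a$ by generalization). Put $$\mathsf{Line}(p,i):=\exists y\Big(\mathsf{Elt}(p,i,y)\land\mathsf{Form}(y)\land\big(\mathsf{Ax}_{\mathsf{A}}(y)\lor\exists j,k<i\,\exists y_1,y_2(\mathsf{Elt}(p,j,y_1)\land\mathsf{Elt}(p,k,y_2)\land\mathsf{MP}(y_1,y_2,y))\lor\exists j<i\,\exists y_1(\mathsf{Elt}(p,j,y_1)\land\mathsf{Gen}(y_1,y))\big)\Big),$$ $$\mathsf{Prf}_{\mathsf{A}}(p,x):=\mathsf{Form}(x)\land\exists n\big(\mathsf{Seq}(p,n)\land n>0\land\mathsf{Elt}(p,n-1,x)\land\forall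 i<n\,\mathsf{Line}(p,i)\big),$$ $$\mathsf{Prov}_{\mathsf{A}}(x):=\exists p\,\mathsf{Prf}_{\mathsf{A}}(p,x),$$ where all quantifiers in $\mathsf{Line}$ and $\mathsf{Prf}_{\mathsf{A}}$ are understood as bounded, so both are $\Delta_0$. **Standing assumptions on the coding.** - Comp: $\vdash_{\mathsf{A}}\ulcorner\varphi\urcorner=\ulcorner\psi\urcorner$ iff $\varphi=\psi$ (codes being written as numerals). - Seq: for fixed $p,i$ there is at most one $y$ with $\mathsf{Elt}(p,i,y)$; if $\mathsf{Seq}(p,n)$ then for each $i<n$ there is exactly one such $y$ (provably in $\mathsf{A}$). - Rule: $\mathsf{A}$ proves the corresponding representability conditions: $\mathsf{Ax}_{\mathsf{A}}(\bar n)$ holds iff $n$ is the code of an axiom of $\mathsf{A}$; $\mathsf{MP}(\bar a,\bar b,\bar c)$ holds iff $a=\ulcorner\varphi\urcorner$, $b=\ulcorner\varphi\to\psi\urcorner$, $c=\ulcorner\psi\urcorner$ for some $\varphi,\psi$; $\mathsf{Gen}(\bar a,\bar c)$ holds iff $a=\ulcorner\varphi\urcorner$, $c=\ulcorner\forall x\,\varphi\urcorner$ for some $\varphi$, $x$. - Len and Pref: there is a primitive recursive function $\mathsf{Pref}(p,k)$ coding the initial segment of length $k$ of the sequence coded by $p$, with $\vdash_{\mathsf{A}}\mathsf{Seq}(\mathsf{Pref}(p,k),k)$ and $\vdash_{\mathsf{A}}\mathsf{Prf}_{\mathsf{A}}(p,\ulcorner\varphi\urcorner)\land\mathsf{Elt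}(p,n,\ulcorner\psi\urcorner)\to\mathsf{Prf}_{\mathsf{A}}(\mathsf{Pref}(p,n+1),\ulcorner\psi\urcorner)$.
   Formalization: "Arithmetic theory" is taken to include that A proves the correct values of sums and products of numerals; without this, closed terms such as 0×0 could denote nonstandard elements and the claim can fail. *)

theory Defs
  imports Main "HOL-Library.Nat_Bijection"
begin

section \<open>Syntax\<close>

text \<open>
  De Bruijn representation, so formulas are taken up to renaming of bound variables.
  A free index \<open>k\<close> of a formula plays the role of a named variable \<open>v\<^sub>k\<close>;
  \<open>all_var k \<phi>\<close> below is the formula \<open>\<forall>v\<^sub>k \<phi>\<close>.
\<close>

datatype tm = Var nat | Zero | Succ tm | Add tm tm | Mul tm tm

datatype fm = Eq tm tm | Bot | Imp fm fm | And fm fm | All fm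

primrec tfv :: "tm \<Rightarrow> nat set" where
  "tfv (Var k) = {k}"
| "tfv Zero = {}"
| "tfv (Succ t) = tfv t"
| "tfv (Add s t) = tfv s \<union> tfv t"
| "tfv (Mul s t) = tfv s \<union> tfv t"

primrec ffv :: "fm \<Rightarrow> nat set" where
  "ffv (Eq s t) = tfv s \<union> tfv t"
| "ffv Bot = {}"
| "ffv (Imp \<phi> \<psi>) = ffv \<phi> \<union> ffv \<psi>"
| "ffv (And \<phi> \<psi>) = ffv \<phi> \<union> ffv \<psi>"
| "ffv (All \<phi>) = {k. Suc k \<in> ffv \<phi>}"

definition closed_tm :: "tm \<Rightarrow> bool" where
  "closed_tm t \<longleftrightarrow> tfv t = {}"

definition closed_fm :: "fm \<Rightarrow> bool" where
  "closed_fm \<phi> \<longleftrightarrow> ffv \<phi> = {}"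

primrec tsubst :: "(nat \<Rightarrow> tm) \<Rightarrow> tm \<Rightarrow> tm" where
  "tsubst \<sigma> (Var k) = \<sigma> k"
| "tsubst \<sigma> Zero = Zero"
| "tsubst \<sigma> (Succ t) = Succ (tsubst \<sigma> t)"
| "tsubst \<sigma> (Add s t) = Add (tsubst \<sigma> s) (tsubst \<sigma> t)"
| "tsubst \<sigma> (Mul s t) = Mul (tsubst \<sigma> s) (tsubst \<sigma> t)"

definition lift :: "tm \<Rightarrow> tm" where
  "lift = tsubst (\<lambda>k. Var (Suc k))"

definition up :: "(nat \<Rightarrow> tm) \<Rightarrow> nat \<Rightarrow> tm" where
  "up \<sigma> = case_nat (Var 0) (\<lambda>k. lift (\<sigma> k))"

primrec fsubst :: "(nat \<Rightarrow> tm) \<Rightarrow> fm \<Rightarrow> fm" where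
  "fsubst \<sigma> (Eq s t) = Eq (tsubst \<sigma> s) (tsubst \<sigma> t)"
| "fsubst \<sigma> Bot = Bot"
| "fsubst \<sigma> (Imp \<phi> \<psi>) = Imp (fsubst \<sigma> \<phi>) (fsubst \<sigma> \<psi>)"
| "fsubst \<sigma> (And \<phi> \<psi>) = And (fsubst \<sigma> \<phi>) (fsubst \<sigma> \<psi>)"
| "fsubst \<sigma> (All \<phi>) = All (fsubst (up \<sigma>) \<phi>)"

text \<open>\<open>inst \<phi> t\<close> replaces the variable bound by the quantifier of \<open>All \<phi>\<close> by \<open>t\<close>.\<close>

definition inst :: "fm \<Rightarrow> tm \<Rightarrow> fm" where
  "inst \<phi> t = fsubst (case_nat t Var) \<phi>"

text \<open>
  \<open>app \<phi> [t\<^sub>0, \<dots>, t\<^sub>n]\<close> is \<open>\<phi>(t\<^sub>0, \<dots>, t\<^sub>n)\<close>, for a formula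
  \<open>\<phi>\<close> whose free variables are among \<open>v\<^sub>0, \<dots>, v\<^sub>n\<close>.
\<close>

definition app :: "fm \<Rightarrow> tm list \<Rightarrow> fm" where
  "app \<phi> ts = fsubst (\<lambda>k. if k < length ts then ts ! k else Var k) \<phi>"

definition all_var :: "nat \<Rightarrow> fm \<Rightarrow> fm" where
  "all_var x \<phi> = All (fsubst (\<lambda>k. if k = x then Var 0 else Var (Suc k)) \<phi>)"

definition Neg :: "fm \<Rightarrow> fm" where
  "Neg \<phi> = Imp \<phi> Bot"

definition Or :: "fm \<Rightarrow> fm \<Rightarrow> fm" where
  "Or \<phi> \<psi> = Neg (And (Neg \<phi>) (Neg \<psi>))"

definition ex_var :: "nat \<Rightarrow> fm \<Rightarrow> fm" where
  "ex_var x \<phi> = Neg (all_var x (Neg \<phi>))"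

primrec num :: "nat \<Rightarrow> tm" where
  "num 0 = Zero"
| "num (Suc n) = Succ (num n)"

text \<open>\<open>t < s\<close>, that is \<open>\<exists>x (t + S(x) = s)\<close> with \<open>x\<close> not in \<open>t\<close>, \<open>s\<close>.\<close>

definition lt :: "tm \<Rightarrow> tm \<Rightarrow> fm" where
  "lt t s = Neg (All (Neg (Eq (Add (lift t) (Succ (Var 0))) (lift s))))"

text \<open>Bounded quantification; only meant for \<open>x\<close> not in \<open>t\<close>.\<close>

definition all_lt :: "nat \<Rightarrow> tm \<Rightarrow> fm \<Rightarrow> fm" where
  "all_lt x t \<phi> = all_var x (Imp (lt (Var x) t) \<phi>)"

definition ex_lt :: "nat \<Rightarrow> tm \<Rightarrow> fm \<Rightarrow> fm" where
  "ex_lt x t \<phi> = Neg (all_lt x t (Neg \<phi>))"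

text \<open>
  In the clause \<open>all\<close>, lifting makes the bound independent of the quantified variable.
  The quantifier hidden in \<open>t < s\<close> counts as bounded (by \<open>s\<close>).
\<close>

inductive delta0 :: "fm \<Rightarrow> bool" where
  eq: "delta0 (Eq s t)"
| bot: "delta0 Bot"
| lt: "delta0 (lt s t)"
| imp: "delta0 \<phi> \<Longrightarrow> delta0 \<psi> \<Longrightarrow> delta0 (Imp \<phi> \<psi>)"
| conj: "delta0 \<phi> \<Longrightarrow> delta0 \<psi> \<Longrightarrow> delta0 (And \<phi> \<psi>)"
| all: "delta0 \<phi> \<Longrightarrow> delta0 (All (Imp (lt (Var 0) (lift t)) \<phi>))"


section \<open>Classical derivability\<close>

text \<open>
  A Hilbert calculus for classical first-order logic with rules modus ponens and
  generalization. Equality is not a logical symbol.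
\<close>

inductive_set logical_axioms :: "fm set" where
  K: "Imp \<phi> (Imp \<psi> \<phi>) \<in> logical_axioms"
| S: "Imp (Imp \<phi> (Imp \<psi> \<chi>)) (Imp (Imp \<phi> \<psi>) (Imp \<phi> \<chi>)) \<in> logical_axioms"
| DN: "Imp (Neg (Neg \<phi>)) \<phi> \<in> logical_axioms"
| conjI: "Imp \<phi> (Imp \<psi> (And \<phi> \<psi>)) \<in> logical_axioms"
| conjE1: "Imp (And \<phi> \<psi>) \<phi> \<in> logical_axioms"
| conjE2: "Imp (And \<phi> \<psi>) \<psi> \<in> logical_axioms"
| allE: "Imp (All \<phi>) (inst \<phi> t) \<in> logical_axioms"
| allI: "x \<notin> ffv \<phi> \<Longrightarrow>
    Imp (all_var x (Imp \<phi> \<psi>)) (Imp \<phi> (all_var x \<psi>)) \<in> logical_axioms"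

text \<open>
  A theory is given by its set \<open>A\<close> of closed non-logical axioms; \<open>axioms A\<close> is the set
  that derivations may start from.
\<close>

definition axioms :: "fm set \<Rightarrow> fm set" where
  "axioms A = A \<union> logical_axioms"

inductive derivable :: "fm set \<Rightarrow> fm \<Rightarrow> bool" (infix "\<turnstile>" 50) for A where
  ax: "\<phi> \<in> axioms A \<Longrightarrow> A \<turnstile> \<phi>"
| mp: "A \<turnstile> \<phi> \<Longrightarrow> A \<turnstile> Imp \<phi> \<psi> \<Longrightarrow> A \<turnstile> \<psi>"
| gen: "A \<turnstile> \<phi> \<Longrightarrow> A \<turnstile> all_var x \<phi>"


section \<open>Bases and support\<close>

type_synonym atom = "tm \<times> tm"
type_synonym atomic_rule = "atom list \<times> atom"

definition closed_atom :: "atom \<Rightarrow> bool" where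
  "closed_atom P \<longleftrightarrow> closed_tm (fst P) \<and> closed_tm (snd P)"

definition base :: "atomic_rule set \<Rightarrow> bool" where
  "base B \<longleftrightarrow> (\<forall>(Ps, C) \<in> B. (\<forall>P \<in> set Ps. closed_atom P) \<and> closed_atom C)"

inductive base_derivable :: "atomic_rule set \<Rightarrow> atom \<Rightarrow> bool" for B where
  "(Ps, C) \<in> B \<Longrightarrow> (\<And>P. P \<in> set Ps \<Longrightarrow> base_derivable B P) \<Longrightarrow> base_derivable B C"

primrec fm_size :: "fm \<Rightarrow> nat" where
  "fm_size (Eq s t) = 0"
| "fm_size Bot = 0"
| "fm_size (Imp \<phi> \<psi>) = Suc (fm_size \<phi> + fm_size \<psi>)"
| "fm_size (And \<phi> \<psi>) = Suc (fm_size \<phi> + fm_size \<psi>)"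
| "fm_size (All \<phi>) = Suc (fm_size \<phi>)"

lemma fm_size_fsubst [simp]: "fm_size (fsubst \<sigma> \<phi>) = fm_size \<phi>"
  by (induction \<phi> arbitrary: \<sigma>) auto

lemma fm_size_inst [simp]: "fm_size (inst \<phi> t) = fm_size \<phi>"
  by (simp add: inst_def)

function supports :: "atomic_rule set \<Rightarrow> fm \<Rightarrow> bool" where
  "supports B (Eq s t) \<longleftrightarrow> base_derivable B (s, t)"
| "supports B Bot \<longleftrightarrow> (\<forall>P. closed_atom P \<longrightarrow> base_derivable B P)"
| "supports B (Imp \<phi> \<psi>) \<longleftrightarrow>
    (\<forall>C. base C \<and> B \<subseteq> C \<longrightarrow> supports C \<phi> \<longrightarrow> supports C \<psi>)"
| "supports B (And \<phi> \<psi>) \<longleftrightarrow> supports B \<phi> \<and> supports B \<psi>"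
| "supports B (All \<phi>) \<longleftrightarrow> (\<forall>t. closed_tm t \<longrightarrow> supports B (inst \<phi> t))"
  by pat_completeness auto
termination
  by (relation "measure (\<lambda>(B, \<phi>). fm_size \<phi>)") auto

definition supports_from :: "fm set \<Rightarrow> atomic_rule set \<Rightarrow> fm \<Rightarrow> bool" where
  "supports_from \<Delta> B \<phi> \<longleftrightarrow>
    (\<forall>C. base C \<and> B \<subseteq> C \<longrightarrow> (\<forall>\<psi> \<in> \<Delta>. supports C \<psi>) \<longrightarrow> supports C \<phi>)"

definition valid :: "fm set \<Rightarrow> fm \<Rightarrow> bool" (infix "\<tturnstile>" 50) where
  "\<Gamma> \<tturnstile> \<phi> \<longleftrightarrow> supports_from \<Gamma> {} \<phi>"


section \<open>Recursive functions\<close>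

text \<open>
  \<open>rec_fun False n f\<close>: \<open>f\<close> is primitive recursive of arity \<open>n\<close>; \<open>rec_fun True n f\<close>:
  \<open>f\<close> is total recursive of arity \<open>n\<close> (closure also under regular minimization). Only the
  values of \<open>f\<close> on lists of length \<open>n\<close> matter.
\<close>

inductive rec_fun :: "bool \<Rightarrow> nat \<Rightarrow> (nat list \<Rightarrow> nat) \<Rightarrow> bool" for mu where
  zero: "rec_fun mu n (\<lambda>xs. 0)"
| succ: "rec_fun mu 1 (\<lambda>xs. Suc (xs ! 0))"
| proj: "i < n \<Longrightarrow> rec_fun mu n (\<lambda>xs. xs ! i)"
| comp: "rec_fun mu (length fs) g \<Longrightarrow> (\<And>f. f \<in> set fs \<Longrightarrow> rec_fun mu n f) \<Longrightarrow>
    rec_fun mu n (\<lambda>xs. g (map (\<lambda>f. f xs) fs))"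
| prec: "rec_fun mu n g \<Longrightarrow> rec_fun mu (Suc (Suc n)) h \<Longrightarrow>
    rec_fun mu (Suc n) (\<lambda>xs. rec_nat (g (tl xs)) (\<lambda>k r. h (k # r # tl xs)) (hd xs))"
| minim: "mu \<Longrightarrow> rec_fun mu (Suc n) g \<Longrightarrow>
    (\<And>xs. length xs = n \<Longrightarrow> \<exists>y. g (y # xs) = 0) \<Longrightarrow>
    rec_fun mu n (\<lambda>xs. LEAST y. g (y # xs) = 0)"

text \<open>A reference numbering, used only to say when an arbitrary numbering is effective.\<close>

primrec tm_code :: "tm \<Rightarrow> nat" where
  "tm_code (Var k) = prod_encode (0, k)"
| "tm_code Zero = prod_encode (1, 0)"
| "tm_code (Succ t) = prod_encode (2, tm_code t)"
| "tm_code (Add s t) = prod_encode (3, prod_encode (tm_code s, tm_code t))"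
| "tm_code (Mul s t) = prod_encode (4, prod_encode (tm_code s, tm_code t))"

primrec fm_code :: "fm \<Rightarrow> nat" where
  "fm_code (Eq s t) = prod_encode (0, prod_encode (tm_code s, tm_code t))"
| "fm_code Bot = prod_encode (1, 0)"
| "fm_code (Imp \<phi> \<psi>) = prod_encode (2, prod_encode (fm_code \<phi>, fm_code \<psi>))"
| "fm_code (And \<phi> \<psi>) = prod_encode (3, prod_encode (fm_code \<phi>, fm_code \<psi>))"
| "fm_code (All \<phi>) = prod_encode (4, fm_code \<phi>)"

definition effective :: "(fm \<Rightarrow> nat) \<Rightarrow> bool" where
  "effective g \<longleftrightarrow> (\<exists>F G. rec_fun True 1 F \<and> rec_fun True 1 G \<and>
    (\<forall>\<phi>. F [fm_code \<phi>] = g \<phi> \<and> G [g \<phi>] = fm_code \<phi>))"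


section \<open>Theories\<close>

text \<open>
  An arithmetic theory consists of closed formulas and proves the axioms of equality and
  the correct values of sums and products of numerals. (Derivability of an open formula is derivability of its
  universal closure.)
\<close>

definition arithmetic_theory :: "fm set \<Rightarrow> bool" where
  "arithmetic_theory A \<longleftrightarrow>
    (\<forall>\<phi> \<in> A. closed_fm \<phi>) \<and>
    A \<turnstile> Eq (Var 0) (Var 0) \<and>
    A \<turnstile> Imp (Eq (Var 0) (Var 1)) (Eq (Var 1) (Var 0)) \<and>
    A \<turnstile> Imp (Eq (Var 0) (Var 1)) (Imp (Eq (Var 1) (Var 2)) (Eq (Var 0) (Var 2))) \<and>
    A \<turnstile> Imp (Eq (Var 0) (Var 1)) (Eq (Succ (Var 0)) (Succ (Var 1))) \<and>
    A \<turnstile> Imp (Eq (Var 0) (Var 1)) (Imp (Eq (Var 2) (Var 3))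
          (Eq (Add (Var 0) (Var 2)) (Add (Var 1) (Var 3)))) \<and>
    A \<turnstile> Imp (Eq (Var 0) (Var 1)) (Imp (Eq (Var 2) (Var 3))
          (Eq (Mul (Var 0) (Var 2)) (Mul (Var 1) (Var 3)))) \<and>
    (\<forall>m n. A \<turnstile> Eq (Add (num m) (num n)) (num (m + n))) \<and>
    (\<forall>m n. A \<turnstile> Eq (Mul (num m) (num n)) (num (m * n)))"

definition sufficiently_strong :: "fm set \<Rightarrow> bool" where
  "sufficiently_strong A \<longleftrightarrow>
    (\<forall>m n. A \<turnstile> Eq (num m) (num n) \<longleftrightarrow> m = n) \<and>
    (\<forall>\<delta>. delta0 \<delta> \<and> closed_fm \<delta> \<longrightarrow> A \<turnstile> \<delta> \<or> A \<turnstile> Neg \<delta>)"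

text \<open>\<open>g\<close> is the numbering of formulas.\<close>

definition recursively_axiomatizable :: "(fm \<Rightarrow> nat) \<Rightarrow> fm set \<Rightarrow> bool" where
  "recursively_axiomatizable g A \<longleftrightarrow>
    (\<exists>F. rec_fun False 1 F \<and> range (\<lambda>n. F [n]) = g ` axioms A)"


section \<open>Provability predicate\<close>

text \<open>
  \<open>seq_of p\<close> is the sequence coded by \<open>p\<close>, if any; a sequence may have several codes.
  \<open>Bnd\<close> is a term in the variable \<open>v\<^sub>0\<close> (standing for \<open>p\<close>) that serves as bound for the
  quantifiers over lengths and entries of the sequence coded by \<open>p\<close>.
\<close>

record coding =
  gn :: "fm \<Rightarrow> nat"
  seq_of :: "nat \<Rightarrow> nat list option"
  Form :: fm
  Seq :: fm
  Elt :: fm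
  Ax :: fm
  MP :: fm
  Gen :: fm
  Bnd :: tm
  Pref :: "nat \<Rightarrow> nat \<Rightarrow> nat"

text \<open>Free variables: \<open>p = v\<^sub>0\<close> and \<open>i = v\<^sub>1\<close>.\<close>

definition Line :: "coding \<Rightarrow> fm" where
  "Line K =
    (let p = Var 0; i = Var 1; y = Var 2; j = Var 3; k = Var 4; y1 = Var 5; y2 = Var 6 in
     ex_lt 2 (Bnd K)
      (And (app (Elt K) [p, i, y])
      (And (app (Form K) [y])
      (Or (app (Ax K) [y])
      (Or (ex_lt 3 i (ex_lt 4 i (ex_lt 5 (Bnd K) (ex_lt 6 (Bnd K)
             (And (app (Elt K) [p, j, y1])
             (And (app (Elt K) [p, k, y2])
                  (app (MP K) [y1, y2, y])))))))
          (ex_lt 3 i (ex_lt 5 (Bnd K)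
             (And (app (Elt K) [p, j, y1])
                  (app (Gen K) [y1, y])))))))))"

text \<open>
  Free variables: \<open>p = v\<^sub>0\<close> and \<open>x = v\<^sub>1\<close>. The variable \<open>m\<close> is the predecessor
  of \<open>n\<close>.
\<close>

definition Prf :: "coding \<Rightarrow> fm" where
  "Prf K =
    (let p = Var 0; x = Var 1; n = Var 2; i = Var 3; m = Var 4 in
     And (app (Form K) [x])
      (ex_lt 2 (Bnd K)
        (And (app (Seq K) [p, n])
        (And (lt Zero n)
        (And (ex_lt 4 n (And (Eq (Succ m) n) (app (Elt K) [p, m, x])))
             (all_lt 3 n (app (Line K) [p, i])))))))"

text \<open>Free variable: \<open>x = v\<^sub>0\<close>.\<close>

definition Prov :: "coding \<Rightarrow> fm" where
  "Prov K = ex_var 1 (app (Prf K) [Var 1, Var 0])"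

definition quote :: "coding \<Rightarrow> fm \<Rightarrow> tm" where
  "quote K \<phi> = num (gn K \<phi>)"

definition Con :: "coding \<Rightarrow> fm" where
  "Con K = Neg (app (Prov K) [quote K Bot])"

definition delta0_of_arity :: "nat \<Rightarrow> fm \<Rightarrow> bool" where
  "delta0_of_arity n \<phi> \<longleftrightarrow> delta0 \<phi> \<and> ffv \<phi> \<subseteq> {..<n}"

primrec tm_val :: "(nat \<Rightarrow> nat) \<Rightarrow> tm \<Rightarrow> nat" where
  "tm_val e (Var k) = e k"
| "tm_val e Zero = 0"
| "tm_val e (Succ t) = Suc (tm_val e t)"
| "tm_val e (Add s t) = tm_val e s + tm_val e t"
| "tm_val e (Mul s t) = tm_val e s * tm_val e t"

definition well_formed_coding :: "coding \<Rightarrow> bool" where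
  "well_formed_coding K \<longleftrightarrow>
    effective (gn K) \<and>
    (\<forall>xs. \<exists>p. seq_of K p = Some xs) \<and>
    delta0_of_arity 1 (Form K) \<and>
    delta0_of_arity 2 (Seq K) \<and>
    delta0_of_arity 3 (Elt K) \<and>
    delta0_of_arity 1 (Ax K) \<and>
    delta0_of_arity 3 (MP K) \<and>
    delta0_of_arity 2 (Gen K) \<and>
    tfv (Bnd K) \<subseteq> {0} \<and>
    (\<forall>p xs. seq_of K p = Some xs \<longrightarrow>
      (\<forall>y \<in> insert (length xs) (set xs). y < tm_val (\<lambda>_. p) (Bnd K)))"

definition Comp_cond :: "fm set \<Rightarrow> coding \<Rightarrow> bool" where
  "Comp_cond A K \<longleftrightarrow> (\<forall>\<phi> \<psi>. A \<turnstile> Eq (quote K \<phi>) (quote K \<psi>) \<longleftrightarrow> \<phi> = \<psi>)"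

text \<open>
  Here and below, codes, lengths and positions range over numerals. The first two conjuncts
  say that \<open>Seq\<close> and \<open>Elt\<close> have their intended meaning; on codes of sequences this
  leaves \<open>Elt\<close> unconstrained beyond the length.
\<close>

definition Seq_cond :: "fm set \<Rightarrow> coding \<Rightarrow> bool" where
  "Seq_cond A K \<longleftrightarrow>
    (\<forall>p n. A \<turnstile> app (Seq K) [num p, num n] \<longleftrightarrow>
      (\<exists>xs. seq_of K p = Some xs \<and> length xs = n)) \<and>
    (\<forall>p xs i y. seq_of K p = Some xs \<and> i < length xs \<longrightarrow>
      (A \<turnstile> app (Elt K) [num p, num i, num y] \<longleftrightarrow> xs ! i = y)) \<and>
    (\<forall>p i. A \<turnstile> all_var 0 (all_var 1
      (Imp (And (app (Elt K) [num p, num i, Var 0]) (app (Elt K) [num p, num i, Var 1]))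
           (Eq (Var 0) (Var 1))))) \<and>
    (\<forall>p n. A \<turnstile> Imp (app (Seq K) [num p, num n])
      (all_lt 0 (num n) (ex_var 1
        (And (app (Elt K) [num p, Var 0, Var 1])
             (all_var 2 (Imp (app (Elt K) [num p, Var 0, Var 2]) (Eq (Var 2) (Var 1))))))))"

definition Rule_cond :: "fm set \<Rightarrow> coding \<Rightarrow> bool" where
  "Rule_cond A K \<longleftrightarrow>
    (\<forall>n. A \<turnstile> app (Form K) [num n] \<longleftrightarrow> (\<exists>\<phi>. n = gn K \<phi>)) \<and>
    (\<forall>n. A \<turnstile> app (Ax K) [num n] \<longleftrightarrow> (\<exists>\<phi> \<in> axioms A. n = gn K \<phi>)) \<and>
    (\<forall>a b c. A \<turnstile> app (MP K) [num a, num b, num c] \<longleftrightarrow>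
      (\<exists>\<phi> \<psi>. a = gn K \<phi> \<and> b = gn K (Imp \<phi> \<psi>) \<and> c = gn K \<psi>)) \<and>
    (\<forall>a c. A \<turnstile> app (Gen K) [num a, num c] \<longleftrightarrow>
      (\<exists>\<phi> x. a = gn K \<phi> \<and> c = gn K (all_var x \<phi>)))"

definition Pref_cond :: "fm set \<Rightarrow> coding \<Rightarrow> bool" where
  "Pref_cond A K \<longleftrightarrow>
    (\<exists>F. rec_fun False 2 F \<and> (\<forall>p k. Pref K p k = F [p, k])) \<and>
    (\<forall>p xs k. seq_of K p = Some xs \<and> k \<le> length xs \<longrightarrow>
      seq_of K (Pref K p k) = Some (take k xs) \<and>
      A \<turnstile> app (Seq K) [num (Pref K p k), num k]) \<and>
    (\<forall>p n \<phi> \<psi>. A \<turnstile>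
      Imp (And (app (Prf K) [num p, quote K \<phi>]) (app (Elt K) [num p, num n, quote K \<psi>]))
          (app (Prf K) [num (Pref K p (n + 1)), quote K \<psi>]))"

text \<open>\<open>K\<close> provides a coding of syntax and a provability predicate for \<open>A\<close>.\<close>

definition coding_for :: "fm set \<Rightarrow> coding \<Rightarrow> bool" where
  "coding_for A K \<longleftrightarrow> well_formed_coding K \<and>
    Comp_cond A K \<and> Seq_cond A K \<and> Rule_cond A K \<and> Pref_cond A K"

end

theory Submission
  imports Defs
begin

text \<open>
  Classical logic is sound for support: a formula and its double negation have the same
  support, because a base can be extended by the rules leading from an atom \<open>P\<close> to every atom,
  and a derivation of \<open>P\<close> in the extended base contains one in the original base.

  Now let a base support \<open>A\<close> without supporting \<open>\<bottom>\<close>. As \<open>A\<close> proves every closed term equal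
  to a numeral and refutes equations between distinct numerals, the base derives exactly the
  true closed equations, and so does each of its extensions that does not support \<open>\<bottom>\<close>. Hence
  support by such a base is truth in the standard model, which is therefore a model of \<open>A\<close>.
  If the base supported \<open>Prov(\<bottom>)\<close>, some natural number would satisfy the proof predicate for
  \<open>\<bottom>\<close>. The \<open>\<Delta>\<^sub>0\<close> formulas occurring in it are decided correctly by \<open>A\<close>, so this number
  would code an actual derivation of \<open>\<bottom>\<close> from \<open>A\<close>, and soundness gives support of \<open>\<bottom>\<close>.
\<close>

section \<open>Substitution\<close>

lemma tsubst_tsubst: "tsubst \<sigma> (tsubst \<tau> t) = tsubst (\<lambda>k. tsubst \<sigma> (\<tau> k)) t"
  by (induction t) auto

lemma tsubst_cong: "(\<And>k. k \<in> tfv t \<Longrightarrow> \<sigma> k = \<tau> k) \<Longrightarrow> tsubst \<sigma> t = tsubst \<tau> t"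
  by (induction t) auto

lemma tsubst_Var [simp]: "tsubst Var t = t"
  by (induction t) auto

lemma tfv_tsubst: "tfv (tsubst \<sigma> t) = (\<Union>k\<in>tfv t. tfv (\<sigma> k))"
  by (induction t) auto

lemma tsubst_up_lift: "tsubst (up \<sigma>) (lift t) = lift (tsubst \<sigma> t)"
  by (simp add: lift_def up_def tsubst_tsubst)

lemma tsubst_case_nat_lift: "tsubst (case_nat u \<sigma>) (lift t) = tsubst \<sigma> t"
  by (simp add: lift_def tsubst_tsubst)

lemma fsubst_fsubst: "fsubst \<sigma> (fsubst \<tau> \<phi>) = fsubst (\<lambda>k. tsubst \<sigma> (\<tau> k)) \<phi>"
proof (induction \<phi> arbitrary: \<sigma> \<tau>)
  case (All \<phi>)
  have "(\<lambda>k. tsubst (up \<sigma>) (up \<tau> k)) = up (\<lambda>k. tsubst \<sigma> (\<tau> k))"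
    by (rule ext) (auto simp: up_def tsubst_up_lift[unfolded up_def] split: nat.splits)
  with All show ?case by simp
qed (auto simp: tsubst_tsubst)

lemma fsubst_cong: "(\<And>k. k \<in> ffv \<phi> \<Longrightarrow> \<sigma> k = \<tau> k) \<Longrightarrow> fsubst \<sigma> \<phi> = fsubst \<tau> \<phi>"
proof (induction \<phi> arbitrary: \<sigma> \<tau>)
  case (Eq s t)
  then show ?case by (auto intro!: tsubst_cong)
next
  case (Imp \<phi> \<psi>)
  have "fsubst \<sigma> \<phi> = fsubst \<tau> \<phi>" "fsubst \<sigma> \<psi> = fsubst \<tau> \<psi>"
    by (rule Imp.IH, simp add: Imp.prems)+
  then show ?case by simp
next
  case (And \<phi> \<psi>)
  have "fsubst \<sigma> \<phi> = fsubst \<tau> \<phi>" "fsubst \<sigma> \<psi> = fsubst \<tau> \<psi>"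
    by (rule And.IH, simp add: And.prems)+
  then show ?case by simp
next
  case (All \<phi>)
  have "fsubst (up \<sigma>) \<phi> = fsubst (up \<tau>) \<phi>"
    by (rule All.IH) (auto simp: up_def All.prems split: nat.splits)
  then show ?case by simp
qed auto

lemma fsubst_Var [simp]: "fsubst Var \<phi> = \<phi>"
proof (induction \<phi>)
  case (All \<phi>)
  have "up Var = Var"
    by (rule ext) (simp add: up_def lift_def split: nat.splits)
  with All show ?case by simp
qed auto

lemma fsubst_closed: "closed_fm \<phi> \<Longrightarrow> fsubst \<sigma> \<phi> = \<phi>"
  using fsubst_cong[of \<phi> \<sigma> Var] by (simp add: closed_fm_def)

text \<open>Lifting under the binder and instantiating it cancel to a single substitution.
  Inductions can therefore run on \<open>\<phi>\<close> with \<open>\<sigma>\<close> arbitrary,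
  although \<open>inst\<close> yields formulas that are not subformulas.\<close>

lemma inst_fsubst_up: "inst (fsubst (up \<sigma>) \<phi>) t = fsubst (case_nat t \<sigma>) \<phi>"
proof -
  have "(\<lambda>k. tsubst (case_nat t Var) (up \<sigma> k)) = case_nat t \<sigma>"
    by (rule ext) (auto simp: up_def tsubst_case_nat_lift split: nat.splits)
  then show ?thesis by (simp add: inst_def fsubst_fsubst)
qed

lemma fsubst_inst: "fsubst \<sigma> (inst \<phi> t) = inst (fsubst (up \<sigma>) \<phi>) (tsubst \<sigma> t)"
proof -
  have "(\<lambda>k. tsubst \<sigma> (case_nat t Var k)) = case_nat (tsubst \<sigma> t) \<sigma>"
    by (rule ext) (auto split: nat.splits)
  then show ?thesis by (simp add: inst_fsubst_up) (simp add: inst_def fsubst_fsubst)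
qed

lemma fsubst_lt: "fsubst \<sigma> (lt s t) = lt (tsubst \<sigma> s) (tsubst \<sigma> t)"
  by (simp add: lt_def Neg_def tsubst_up_lift) (simp add: up_def)

text \<open>A bounded quantifier stays one because \<open>up \<sigma>\<close> fixes index 0 and
  commutes with \<open>lift\<close>, so the bound is again a lifted term.\<close>

lemma delta0_fsubst: "delta0 \<phi> \<Longrightarrow> delta0 (fsubst \<sigma> \<phi>)"
proof (induction arbitrary: \<sigma> rule: delta0.induct)
  case (all \<phi> t)
  then have "delta0 (All (Imp (lt (Var 0) (lift (tsubst \<sigma> t))) (fsubst (up \<sigma>) \<phi>)))"
    by (intro delta0.all)
  moreover have "tsubst (up \<sigma>) (Var 0) = Var 0"
    by (simp add: up_def)
  ultimately show ?case by (simp add: fsubst_lt tsubst_up_lift del: tsubst.simps)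
qed (auto simp: fsubst_lt intro: delta0.intros)

lemma ffv_fsubst: "ffv (fsubst \<sigma> \<phi>) = (\<Union>k\<in>ffv \<phi>. tfv (\<sigma> k))"
proof (induction \<phi> arbitrary: \<sigma>)
  case (All \<phi>)
  have "Suc j \<in> tfv (up \<sigma> k) \<longleftrightarrow> (\<exists>i. k = Suc i \<and> j \<in> tfv (\<sigma> i))" for j k
    by (cases k) (auto simp: up_def lift_def tfv_tsubst)
  with All show ?case by auto
qed (auto simp: tfv_tsubst)

lemma ffv_app_subset:
  assumes "ffv \<phi> \<subseteq> {..<length ts}"
  shows "ffv (app \<phi> ts) \<subseteq> (\<Union>t\<in>set ts. tfv t)"
  using assms by (auto simp: app_def ffv_fsubst subset_iff split: if_splits intro: bexI[OF _ nth_mem])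

section \<open>Free variables of the defined connectives\<close>

lemma ffv_Neg [simp]: "ffv (Neg \<phi>) = ffv \<phi>"
  by (simp add: Neg_def)

lemma ffv_Or [simp]: "ffv (Or \<phi> \<psi>) = ffv \<phi> \<union> ffv \<psi>"
  by (simp add: Or_def)

lemma ffv_all_var [simp]: "ffv (all_var x \<phi>) = ffv \<phi> - {x}"
  by (auto simp: all_var_def ffv_fsubst split: if_splits)

lemma ffv_ex_var [simp]: "ffv (ex_var x \<phi>) = ffv \<phi> - {x}"
  by (simp add: ex_var_def)

lemma ffv_lt [simp]: "ffv (lt s t) = tfv s \<union> tfv t"
  by (auto simp: lt_def lift_def tfv_tsubst)

lemma ffv_all_lt [simp]: "ffv (all_lt x t \<phi>) = tfv t \<union> ffv \<phi> - {x}"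
  by (auto simp: all_lt_def)

lemma ffv_ex_lt [simp]: "ffv (ex_lt x t \<phi>) = tfv t \<union> ffv \<phi> - {x}"
  by (simp add: ex_lt_def)

text \<open>Derivations pass through open formulas, while support concerns closed ones; such
  substitutions turn the former into the latter. Closedness at every index keeps the notion stable
  under updates and under \<open>case_nat\<close>.\<close>

definition closing :: "(nat \<Rightarrow> tm) \<Rightarrow> bool" where
  "closing \<sigma> \<longleftrightarrow> (\<forall>k. closed_tm (\<sigma> k))"

lemma closing_tsubst: "closing \<sigma> \<Longrightarrow> closed_tm (tsubst \<sigma> t)"
  by (auto simp: closing_def closed_tm_def tfv_tsubst)

lemma closing_case_nat: "closing \<sigma> \<Longrightarrow> closed_tm t \<Longrightarrow> closing (case_nat t \<sigma>)"
  by (auto simp: closing_def split: nat.splits)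

lemma closing_fun_upd: "closing \<sigma> \<Longrightarrow> closed_tm t \<Longrightarrow> closing (\<sigma>(x := t))"
  by (auto simp: closing_def)

lemma closed_tm_num [simp]: "closed_tm (num n)"
  by (induction n) (auto simp: closed_tm_def)

lemma closing_num: "closing (\<lambda>k. num (e k))"
  by (simp add: closing_def)


section \<open>Soundness of classical logic for support\<close>

lemma base_derivable_mono: "base_derivable B P \<Longrightarrow> B \<subseteq> C \<Longrightarrow> base_derivable C P"
  by (induction rule: base_derivable.induct) (auto intro: base_derivable.intros)

lemma supports_mono: "supports B \<phi> \<Longrightarrow> B \<subseteq> C \<Longrightarrow> supports C \<phi>"
proof (induction B \<phi> arbitrary: C rule: supports.induct)
  case (3 B \<phi> \<psi>)
  then show ?case by (simp only: supports.simps) (meson order_trans)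
qed (auto intro: base_derivable_mono)

lemma supports_mp:
  "supports B (Imp \<phi> \<psi>) \<Longrightarrow> base B \<Longrightarrow> supports B \<phi> \<Longrightarrow> supports B \<psi>"
  by simp

lemma supports_All_fsubst:
  "supports B (fsubst \<sigma> (All \<phi>)) \<longleftrightarrow>
    (\<forall>t. closed_tm t \<longrightarrow> supports B (fsubst (case_nat t \<sigma>) \<phi>))"
  by (simp add: inst_fsubst_up)

text \<open>The named quantifier becomes an update of the substitution, the form that suits the
  axiom \<open>allI\<close> and the generalization rule.\<close>

lemma supports_all_var_fsubst:
  "supports B (fsubst \<sigma> (all_var x \<phi>)) \<longleftrightarrow>
    (\<forall>t. closed_tm t \<longrightarrow> supports B (fsubst (\<sigma>(x := t)) \<phi>))"
proof -
  have "(\<lambda>k. tsubst (case_nat t \<sigma>) (if k = x then Var 0 else Var (Suc k))) = \<sigma>(x := t)" for t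
    by auto
  then show ?thesis
    unfolding all_var_def supports_All_fsubst by (simp add: fsubst_fsubst)
qed

text \<open>The clause for \<open>Bot\<close> yields closed atoms only, which is why
  \<open>\<sigma>\<close> has to be closing. For an implication, \<open>Bot\<close> persists to
  every extension and gives the conclusion there.\<close>

lemma supports_ex_falso:
  "supports B Bot \<Longrightarrow> closing \<sigma> \<Longrightarrow> supports B (fsubst \<sigma> \<phi>)"
proof (induction \<phi> arbitrary: B \<sigma>)
  case (Eq s t)
  then show ?case by (simp add: closed_atom_def closing_tsubst)
next
  case (Imp \<phi> \<psi>)
  then show ?case using supports_mono[OF \<open>supports B Bot\<close>] by auto
next
  case (All \<phi>)
  then show ?case unfolding supports_All_fsubst by (blast intro: closing_case_nat)
qed auto

text \<open>Contraposition, twice. As the first assumption concerns only extensions of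
  \<open>B\<close>, it may exploit anything that \<open>B\<close> already supports.\<close>

lemma supports_double_neg_mono:
  assumes "\<And>C. base C \<Longrightarrow> B \<subseteq> C \<Longrightarrow> supports C \<phi> \<Longrightarrow> supports C \<psi>"
    and "supports B (Neg (Neg \<phi>))"
  shows "supports B (Neg (Neg \<psi>))"
  unfolding Neg_def supports.simps(3)[of B "Imp \<psi> Bot"]
proof (intro HOL.allI impI)
  fix C assume C: "base C \<and> B \<subseteq> C" and neg: "supports C (Imp \<psi> Bot)"
  have "supports C (Imp \<phi> Bot)"
    using assms(1) neg C by (simp only: supports.simps(3)) (meson order_trans)
  with assms(2) C show "supports C Bot"
    unfolding Neg_def by (simp only: supports.simps(3))
qed

text \<open>Each new rule has \<open>P\<close> as its sole premise, so a derivation that uses one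
  contains a derivation of \<open>P\<close>; the induction hypothesis for that premise gives
  \<open>P\<close> in \<open>B\<close>.\<close>

lemma base_derivable_explosion:
  assumes "base_derivable (B \<union> {([P], Q) |Q. closed_atom Q}) R"
  shows "base_derivable B R \<or> base_derivable B P"
  using assms
proof (induction rule: base_derivable.induct)
  case (1 Ps C)
  show ?case
  proof (cases "(Ps, C) \<in> B")
    case True
    with 1(3) show ?thesis by (blast intro: base_derivable.intros)
  next
    case False
    with 1(1) have "Ps = [P]" by auto
    with 1(3) show ?thesis by simp
  qed
qed

lemma supports_double_neg_atom:
  assumes "base B" "closed_tm s" "closed_tm t" "supports B (Neg (Neg (Eq s t)))"
  shows "supports B (Eq s t)"
proof -
  \<comment> \<open>In \<open>C\<close> the atom \<open>(s, t)\<close> is explosive, so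
    \<open>C\<close> supports the negation of the equation. The double negation then makes
    \<open>C\<close> derive every closed atom, \<open>(s, t)\<close> included.\<close>
  define C where "C = B \<union> {([(s, t)], Q) |Q. closed_atom Q}"
  have C: "base C" "B \<subseteq> C"
    using assms(1-3) by (auto simp: C_def base_def closed_atom_def)
  have "base_derivable D Q" if "C \<subseteq> D" "base_derivable D (s, t)" "closed_atom Q" for D Q
  proof (rule base_derivable.intros)
    show "([(s, t)], Q) \<in> D" using that(1,3) unfolding C_def by blast
  qed (use that in auto)
  then have "supports C (Neg (Eq s t))"
    by (auto simp: Neg_def)
  with assms(4) C have "supports C Bot"
    unfolding Neg_def by (simp only: supports.simps(3))
  then have "base_derivable C (s, t)"
    using assms by (simp add: closed_atom_def)
  then show ?thesis
    using base_derivable_explosion[of B "(s, t)" "(s, t)"] unfolding C_def by auto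
qed

text \<open>The double negation moves inwards through conjunctions, universal quantifiers and
  conclusions of implications until it reaches an atom or \<open>Bot\<close>. Disjunction and
  existence are abbreviations, so no other case arises.\<close>

lemma supports_double_neg:
  "base B \<Longrightarrow> closing \<sigma> \<Longrightarrow> supports B (Neg (Neg (fsubst \<sigma> \<phi>))) \<Longrightarrow>
    supports B (fsubst \<sigma> \<phi>)"
proof (induction \<phi> arbitrary: B \<sigma>)
  case (Eq s t)
  then show ?case
    using supports_double_neg_atom[of B "tsubst \<sigma> s" "tsubst \<sigma> t"] by (simp add: closing_tsubst)
next
  case Bot
  have "supports B (Neg Bot)" by (simp add: Neg_def)
  with Bot show ?case
    unfolding Neg_def fsubst.simps by (blast intro: supports_mp)
next
  case (Imp \<phi> \<psi>)
  show ?case unfolding fsubst.simps supports.simps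
  proof (intro HOL.allI impI)
    fix C assume C: "base C \<and> B \<subseteq> C" and \<phi>: "supports C (fsubst \<sigma> \<phi>)"
    have "supports C (Neg (Neg (fsubst \<sigma> (Imp \<phi> \<psi>))))"
      using Imp.prems(3) C by (blast intro: supports_mono)
    then have "supports C (Neg (Neg (fsubst \<sigma> \<psi>)))"
      by (rule supports_double_neg_mono[rotated])
        (use \<phi> in \<open>auto intro: supports_mp supports_mono\<close>)
    then show "supports C (fsubst \<sigma> \<psi>)"
      using Imp.IH(2) Imp.prems(2) C by blast
  qed
next
  case (And \<phi> \<psi>)
  have "supports B (Neg (Neg (fsubst \<sigma> \<phi>)))" "supports B (Neg (Neg (fsubst \<sigma> \<psi>)))"
    by (rule supports_double_neg_mono[OF _ And.prems(3)], simp)+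
  with And show ?case by simp
next
  case (All \<phi>)
  show ?case unfolding supports_All_fsubst
  proof (intro HOL.allI impI)
    fix t assume t: "closed_tm t"
    have "supports B (Neg (Neg (fsubst (case_nat t \<sigma>) \<phi>)))"
      by (rule supports_double_neg_mono[OF _ All.prems(3)])
        (use t in \<open>simp only: supports_All_fsubst\<close>)
    then show "supports B (fsubst (case_nat t \<sigma>) \<phi>)"
      using All t by (blast intro: closing_case_nat)
  qed
qed

lemma supports_logical_axiom:
  assumes "\<phi> \<in> logical_axioms" "closing \<sigma>"
  shows "supports B (fsubst \<sigma> \<phi>)"
  using assms(1)
proof cases
  case (K \<phi> \<psi>)
  then show ?thesis by (auto intro: supports_mono)
next
  case (S \<phi> \<psi> \<chi>)
  then show ?thesis by simp (meson order_refl order_trans)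
next
  case (DN \<psi>)
  then show ?thesis
    using supports_double_neg[OF _ assms(2), of _ \<psi>] unfolding Neg_def by simp
next
  case (conjI \<phi> \<psi>)
  then show ?thesis by (auto intro: supports_mono)
next
  case (allE \<phi> t)
  then show ?thesis
    using closing_tsubst[OF assms(2)] by (auto simp: fsubst_inst)
next
  case (allI x \<phi> \<psi>)
  \<comment> \<open>\<open>C\<close> and \<open>D\<close> are the successive extensions introduced
    by the two nested implications of the axiom.\<close>
  have "supports D (fsubst \<sigma> (all_var x \<psi>))"
    if base: "base C" "base D" and "C \<subseteq> D" and
      imp: "supports C (fsubst \<sigma> (all_var x (Imp \<phi> \<psi>)))" and
      \<phi>: "supports D (fsubst \<sigma> \<phi>)" for C D
    unfolding supports_all_var_fsubst
  proof (intro HOL.allI impI)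
    fix t assume "closed_tm t"
    with imp have "supports C (Imp (fsubst (\<sigma>(x := t)) \<phi>) (fsubst (\<sigma>(x := t)) \<psi>))"
      unfolding supports_all_var_fsubst by simp
    moreover have "fsubst (\<sigma>(x := t)) \<phi> = fsubst \<sigma> \<phi>"
      using allI by (intro fsubst_cong) auto
    ultimately show "supports D (fsubst (\<sigma>(x := t)) \<psi>)"
      using \<phi> base \<open>C \<subseteq> D\<close> by simp
  qed
  with allI show ?thesis unfolding allI(1) fsubst.simps supports.simps by blast
qed auto

text \<open>Induction on the derivation with \<open>\<sigma>\<close> arbitrary, since generalization
  changes the value at \<open>x\<close>. Members of \<open>A\<close> are closed and hence equal to
  all their instances.\<close>

theorem supports_derivable:
  assumes "A \<turnstile> \<phi>" and "base B" and "\<And>\<psi>. \<psi> \<in> A \<Longrightarrow> closed_fm \<psi> \<and> supports B \<psi>"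
    and "closing \<sigma>"
  shows "supports B (fsubst \<sigma> \<phi>)"
  using assms(1,4)
proof (induction arbitrary: \<sigma> rule: derivable.induct)
  case (ax \<phi>)
  then show ?case
    using assms(3) by (auto simp: axioms_def fsubst_closed intro: supports_logical_axiom)
next
  case (mp \<phi> \<psi>)
  from mp.IH(2)[OF mp.prems] have "supports B (Imp (fsubst \<sigma> \<phi>) (fsubst \<sigma> \<psi>))"
    by simp
  then show ?case
    using assms(2) mp.IH(1)[OF mp.prems] by (rule supports_mp)
next
  case (gen \<phi> x)
  then show ?case
    unfolding supports_all_var_fsubst by (blast intro: closing_fun_upd)
qed


section \<open>Truth in the standard model\<close>

primrec holds :: "(nat \<Rightarrow> nat) \<Rightarrow> fm \<Rightarrow> bool" where
  "holds e (Eq s t) \<longleftrightarrow> tm_val e s = tm_val e t"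
| "holds e Bot \<longleftrightarrow> False"
| "holds e (Imp \<phi> \<psi>) \<longleftrightarrow> (holds e \<phi> \<longrightarrow> holds e \<psi>)"
| "holds e (And \<phi> \<psi>) \<longleftrightarrow> holds e \<phi> \<and> holds e \<psi>"
| "holds e (All \<phi>) \<longleftrightarrow> (\<forall>n. holds (case_nat n e) \<phi>)"

lemma tm_val_tsubst: "tm_val e (tsubst \<sigma> t) = tm_val (\<lambda>k. tm_val e (\<sigma> k)) t"
  by (induction t) auto

lemma tm_val_lift [simp]: "tm_val (case_nat n e) (lift t) = tm_val e t"
  by (simp add: lift_def tm_val_tsubst)

lemma tm_val_num [simp]: "tm_val e (num n) = n"
  by (induction n) auto

lemma holds_fsubst: "holds e (fsubst \<sigma> \<phi>) \<longleftrightarrow> holds (\<lambda>k. tm_val e (\<sigma> k)) \<phi>"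
proof (induction \<phi> arbitrary: e \<sigma>)
  case (All \<phi>)
  have "(\<lambda>k. tm_val (case_nat n e) (up \<sigma> k)) = case_nat n (\<lambda>k. tm_val e (\<sigma> k))" for n
    by (rule ext) (auto simp: up_def split: nat.splits)
  with All show ?case by simp
qed (auto simp: tm_val_tsubst)

lemma holds_app:
  "holds e (app \<phi> ts) \<longleftrightarrow> holds (\<lambda>k. if k < length ts then tm_val e (ts ! k) else e k) \<phi>"
  unfolding app_def holds_fsubst by (rule arg_cong[where f = "\<lambda>e. holds e \<phi>"]) auto

lemma holds_Neg [simp]: "holds e (Neg \<phi>) \<longleftrightarrow> \<not> holds e \<phi>"
  by (simp add: Neg_def)

lemma holds_Or [simp]: "holds e (Or \<phi> \<psi>) \<longleftrightarrow> holds e \<phi> \<or> holds e \<psi>"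
  by (simp add: Or_def)

lemma holds_all_var [simp]: "holds e (all_var x \<phi>) \<longleftrightarrow> (\<forall>n. holds (e(x := n)) \<phi>)"
proof -
  have "(\<lambda>k. tm_val (case_nat n e) (if k = x then Var 0 else Var (Suc k))) = e(x := n)" for n
    by auto
  then show ?thesis by (simp add: all_var_def holds_fsubst)
qed

lemma holds_ex_var [simp]: "holds e (ex_var x \<phi>) \<longleftrightarrow> (\<exists>n. holds (e(x := n)) \<phi>)"
  by (simp add: ex_var_def)

lemma holds_lt [simp]: "holds e (lt s t) \<longleftrightarrow> tm_val e s < tm_val e t"
  by (auto simp: lt_def less_iff_Suc_add intro: sym)

lemma holds_all_lt [simp]:
  "holds e (all_lt x t \<phi>) \<longleftrightarrow> (\<forall>n. n < tm_val (e(x := n)) t \<longrightarrow> holds (e(x := n)) \<phi>)"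
  by (simp add: all_lt_def)

lemma holds_ex_lt [simp]:
  "holds e (ex_lt x t \<phi>) \<longleftrightarrow> (\<exists>n. n < tm_val (e(x := n)) t \<and> holds (e(x := n)) \<phi>)"
  by (simp add: ex_lt_def)


section \<open>Support and truth\<close>

locale strong_arithmetic =
  fixes A :: "fm set"
  assumes arith: "arithmetic_theory A" and strong: "sufficiently_strong A"
begin

text \<open>Excluding \<open>Bot\<close> is what makes such a base behave like a classical structure
  rather than support everything.\<close>

definition consistent_model :: "atomic_rule set \<Rightarrow> bool" where
  "consistent_model B \<longleftrightarrow> base B \<and> (\<forall>\<phi>\<in>A. supports B \<phi>) \<and> \<not> supports B Bot"

lemma model_derivable:
  "consistent_model B \<Longrightarrow> A \<turnstile> \<phi> \<Longrightarrow> closing \<sigma> \<Longrightarrow> supports B (fsubst \<sigma> \<phi>)"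
  using arith by (intro supports_derivable) (auto simp: consistent_model_def arithmetic_theory_def)

lemma model_extend:
  "consistent_model B \<Longrightarrow> base C \<Longrightarrow> B \<subseteq> C \<Longrightarrow> \<not> supports C Bot \<Longrightarrow> consistent_model C"
  unfolding consistent_model_def by (blast intro: supports_mono)

section \<open>Evaluation of closed equations in a model\<close>

context
  fixes B assumes model: "consistent_model B"
begin

lemma model_mp: "supports B (Imp \<phi> \<psi>) \<Longrightarrow> supports B \<phi> \<Longrightarrow> supports B \<psi>"
  using model supports_mp by (auto simp: consistent_model_def)

lemma model_eq_sym:
  assumes "closed_tm s" "closed_tm t" "supports B (Eq s t)"
  shows "supports B (Eq t s)"
proof (rule model_mp[OF _ assms(3)])
  have "A \<turnstile> Imp (Eq (Var 0) (Var 1)) (Eq (Var 1) (Var 0))"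
    using arith by (simp only: arithmetic_theory_def)
  \<comment> \<open>The substitution must be closed at every index, so \<open>t\<close> also serves
    as the default value.\<close>
  from model_derivable[OF model this, of "\<lambda>k. if k = 0 then s else t"]
  show "supports B (Imp (Eq s t) (Eq t s))"
    using assms by (simp add: closing_def del: supports.simps)
qed

lemma model_eq_trans:
  assumes "closed_tm s" "closed_tm t" "closed_tm u" "supports B (Eq s t)" "supports B (Eq t u)"
  shows "supports B (Eq s u)"
proof (rule model_mp[OF model_mp[OF _ assms(4)] assms(5)])
  have "A \<turnstile> Imp (Eq (Var 0) (Var 1)) (Imp (Eq (Var 1) (Var 2)) (Eq (Var 0) (Var 2)))"
    using arith by (simp only: arithmetic_theory_def)
  from model_derivable[OF model this, of "\<lambda>k. if k = 0 then s else if k = 1 then t else u"]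
  show "supports B (Imp (Eq s t) (Imp (Eq t u) (Eq s u)))"
    using assms by (simp add: closing_def del: supports.simps)
qed

lemma model_eq_Succ:
  assumes "closed_tm s" "closed_tm t" "supports B (Eq s t)"
  shows "supports B (Eq (Succ s) (Succ t))"
proof (rule model_mp[OF _ assms(3)])
  have "A \<turnstile> Imp (Eq (Var 0) (Var 1)) (Eq (Succ (Var 0)) (Succ (Var 1)))"
    using arith by (simp only: arithmetic_theory_def)
  from model_derivable[OF model this, of "\<lambda>k. if k = 0 then s else t"]
  show "supports B (Imp (Eq s t) (Eq (Succ s) (Succ t)))"
    using assms by (simp add: closing_def del: supports.simps)
qed

lemma model_eq_Add:
  assumes "closed_tm s" "closed_tm t" "closed_tm s'" "closed_tm t'"
    and "supports B (Eq s t)" "supports B (Eq s' t')"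
  shows "supports B (Eq (Add s s') (Add t t'))"
proof (rule model_mp[OF model_mp[OF _ assms(5)] assms(6)])
  have "A \<turnstile> Imp (Eq (Var 0) (Var 1)) (Imp (Eq (Var 2) (Var 3))
          (Eq (Add (Var 0) (Var 2)) (Add (Var 1) (Var 3))))"
    using arith by (simp only: arithmetic_theory_def)
  from model_derivable[OF model this, of
      "\<lambda>k. if k = 0 then s else if k = 1 then t else if k = 2 then s' else t'"]
  show "supports B (Imp (Eq s t) (Imp (Eq s' t') (Eq (Add s s') (Add t t'))))"
    using assms by (simp add: closing_def del: supports.simps)
qed

lemma model_eq_Mul:
  assumes "closed_tm s" "closed_tm t" "closed_tm s'" "closed_tm t'"
    and "supports B (Eq s t)" "supports B (Eq s' t')"
  shows "supports B (Eq (Mul s s') (Mul t t'))"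
proof (rule model_mp[OF model_mp[OF _ assms(5)] assms(6)])
  have "A \<turnstile> Imp (Eq (Var 0) (Var 1)) (Imp (Eq (Var 2) (Var 3))
          (Eq (Mul (Var 0) (Var 2)) (Mul (Var 1) (Var 3))))"
    using arith by (simp only: arithmetic_theory_def)
  from model_derivable[OF model this, of
      "\<lambda>k. if k = 0 then s else if k = 1 then t else if k = 2 then s' else t'"]
  show "supports B (Imp (Eq s t) (Imp (Eq s' t') (Eq (Mul s s') (Mul t t'))))"
    using assms by (simp add: closing_def del: supports.simps)
qed

lemma model_derivable_Eq:
  assumes "A \<turnstile> Eq s t" "closed_tm s" "closed_tm t"
  shows "supports B (Eq s t)"
proof -
  \<comment> \<open>A closed equation is its own instance; \<open>Zero\<close> is just some closed
    term.\<close>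
  have "fsubst (\<lambda>_. Zero) (Eq s t) = Eq s t"
    using assms(2,3) by (intro fsubst_closed) (simp add: closed_fm_def closed_tm_def)
  then show ?thesis
    using model_derivable[OF model assms(1), of "\<lambda>_. Zero"]
    by (simp add: closing_def closed_tm_def del: supports.simps)
qed

text \<open>Congruence reduces a sum or product to one of numerals, which \<open>A\<close>
  computes.\<close>

lemma model_eq_num: "closed_tm t \<Longrightarrow> supports B (Eq t (num (tm_val e t)))"
proof (induction t)
  case (Var k)
  then show ?case by (simp add: closed_tm_def)
next
  case Zero
  have "A \<turnstile> Eq (num 0) (num 0)"
    using strong unfolding sufficiently_strong_def by blast
  with model_derivable_Eq[OF this] Zero show ?case by (simp del: supports.simps)
next
  case (Succ t)
  then have t: "closed_tm t" by (simp add: closed_tm_def)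
  with Succ.IH model_eq_Succ show ?case by (simp del: supports.simps)
next
  case (Add s t)
  then have cl: "closed_tm s" "closed_tm t" by (simp_all add: closed_tm_def)
  let ?m = "num (tm_val e s)" and ?n = "num (tm_val e t)"
  have cl': "closed_tm (Add ?m ?n)"
    using closed_tm_num unfolding closed_tm_def by simp
  have "A \<turnstile> Eq (Add ?m ?n) (num (tm_val e s + tm_val e t))"
    using arith unfolding arithmetic_theory_def by blast
  then have "supports B (Eq (Add ?m ?n) (num (tm_val e (Add s t))))"
    using model_derivable_Eq cl' by (simp del: supports.simps)
  moreover have "supports B (Eq (Add s t) (Add ?m ?n))"
    using Add.IH cl by (intro model_eq_Add) auto
  ultimately show ?case
    using model_eq_trans[OF Add.prems cl'] by (simp del: supports.simps)
next
  case (Mul s t)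
  then have cl: "closed_tm s" "closed_tm t" by (simp_all add: closed_tm_def)
  let ?m = "num (tm_val e s)" and ?n = "num (tm_val e t)"
  have cl': "closed_tm (Mul ?m ?n)"
    using closed_tm_num unfolding closed_tm_def by simp
  have "A \<turnstile> Eq (Mul ?m ?n) (num (tm_val e s * tm_val e t))"
    using arith unfolding arithmetic_theory_def by blast
  then have "supports B (Eq (Mul ?m ?n) (num (tm_val e (Mul s t))))"
    using model_derivable_Eq cl' by (simp del: supports.simps)
  moreover have "supports B (Eq (Mul s t) (Mul ?m ?n))"
    using Mul.IH cl by (intro model_eq_Mul) auto
  ultimately show ?case
    using model_eq_trans[OF Mul.prems cl'] by (simp del: supports.simps)
qed

text \<open>An equation between distinct numerals is a bounded sentence that \<open>A\<close> does
  not prove, so \<open>A\<close> refutes it; supporting it would give \<open>Bot\<close>.\<close>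

lemma model_num_eq_iff: "supports B (Eq (num m) (num n)) \<longleftrightarrow> m = n"
proof
  assume eq: "supports B (Eq (num m) (num n))"
  have closed: "closed_fm (Eq (num m) (num n))"
    using closed_tm_num unfolding closed_fm_def closed_tm_def by simp
  show "m = n"
  proof (rule ccontr)
    assume "m \<noteq> n"
    with strong closed have "A \<turnstile> Neg (Eq (num m) (num n))"
      unfolding sufficiently_strong_def by (blast intro: delta0.eq)
    from model_derivable[OF model this closing_num[of "\<lambda>_. 0"]]
    have "supports B (Imp (Eq (num m) (num n)) Bot)"
      using fsubst_closed[OF closed] by (simp add: Neg_def del: supports.simps)
    with model_mp eq model show False
      by (auto simp: consistent_model_def simp del: supports.simps)
  qed
next
  assume "m = n"
  then show "supports B (Eq (num m) (num n))"
    using strong unfolding sufficiently_strong_def by (blast intro: model_derivable_Eq closed_tm_num)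
qed

lemma model_Eq_iff:
  assumes "closed_tm s" "closed_tm t"
  shows "supports B (Eq s t) \<longleftrightarrow> tm_val e s = tm_val e t"
proof -
  have "supports B (Eq s t) \<longleftrightarrow> supports B (Eq (num (tm_val e s)) (num (tm_val e t)))"
    using assms model_eq_num[of s e] model_eq_num[of t e]
    by (meson model_eq_sym model_eq_trans closed_tm_num)
  then show ?thesis using model_num_eq_iff by blast
qed

end

text \<open>The right-hand side does not mention \<open>B\<close>, so truth values are shared by all
  models. This collapses the quantification over extensions in an implication: an extension either
  supports \<open>Bot\<close>, hence everything, or is again a model.\<close>

lemma model_supports_iff_holds:
  "consistent_model B \<Longrightarrow> closing \<sigma> \<Longrightarrow>
    supports B (fsubst \<sigma> \<phi>) \<longleftrightarrow> holds (\<lambda>k. tm_val e (\<sigma> k)) \<phi>"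
proof (induction \<phi> arbitrary: B \<sigma>)
  case (Eq s t)
  then show ?case
    using model_Eq_iff[OF Eq.prems(1) closing_tsubst closing_tsubst, of \<sigma> \<sigma> s t e]
    by (simp add: tm_val_tsubst del: supports.simps)
next
  case Bot
  then show ?case by (simp add: consistent_model_def del: supports.simps)
next
  case (Imp \<phi> \<psi>)
  have IH: "supports C (fsubst \<sigma> \<phi>) \<longleftrightarrow> holds (\<lambda>k. tm_val e (\<sigma> k)) \<phi>"
      "supports C (fsubst \<sigma> \<psi>) \<longleftrightarrow> holds (\<lambda>k. tm_val e (\<sigma> k)) \<psi>"
    if "consistent_model C" for C
    using that Imp.IH Imp.prems(2) by auto
  have "supports C (fsubst \<sigma> \<psi>)"
    if "holds (\<lambda>k. tm_val e (\<sigma> k)) (Imp \<phi> \<psi>)" "base C" "B \<subseteq> C" "supports C (fsubst \<sigma> \<phi>)" for C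
  proof (cases "supports C Bot")
    case True
    then show ?thesis using Imp.prems(2) by (rule supports_ex_falso)
  next
    case False
    then have "consistent_model C" using model_extend Imp.prems(1) that by blast
    with IH that show ?thesis by simp
  qed
  moreover have "holds (\<lambda>k. tm_val e (\<sigma> k)) (Imp \<phi> \<psi>)"
    if "supports B (Imp (fsubst \<sigma> \<phi>) (fsubst \<sigma> \<psi>))"
    using IH[OF Imp.prems(1)] model_mp[OF Imp.prems(1) that] by simp
  ultimately show ?case
    unfolding fsubst.simps using supports.simps(3) by blast
next
  case (And \<phi> \<psi>)
  then show ?case by simp
next
  case (All \<phi>)
  have eq: "(\<lambda>k. tm_val e (case_nat t \<sigma> k)) = case_nat (tm_val e t) (\<lambda>k. tm_val e (\<sigma> k))" for t
    by (rule ext) (auto split: nat.splits)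
  have "supports B (fsubst \<sigma> (All \<phi>)) \<longleftrightarrow>
      (\<forall>t. closed_tm t \<longrightarrow> holds (case_nat (tm_val e t) (\<lambda>k. tm_val e (\<sigma> k))) \<phi>)"
    unfolding supports_All_fsubst using All closing_case_nat eq by simp
  \<comment> \<open>Closed terms reach every natural number, as each is the value of its
    numeral.\<close>
  also have "\<dots> \<longleftrightarrow> holds (\<lambda>k. tm_val e (\<sigma> k)) (All \<phi>)"
    by simp (metis closed_tm_num tm_val_num)
  finally show ?case .
qed

text \<open>Substituting the numerals of the values of \<open>e\<close> links derivability to
  support and support to truth.\<close>

lemma derivable_holds:
  assumes "consistent_model B" "A \<turnstile> \<phi>"
  shows "holds e \<phi>"
  using model_derivable[OF assms closing_num[of e]]
    model_supports_iff_holds[OF assms(1) closing_num[of e], of \<phi> "\<lambda>_. 0"] by simp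

text \<open>If a true bounded sentence were not derivable, its negation would be, and hence would be
  true.\<close>

lemma delta0_holds_iff_derivable:
  assumes "consistent_model B" "delta0 \<phi>" "closed_fm \<phi>"
  shows "holds e \<phi> \<longleftrightarrow> A \<turnstile> \<phi>"
  using strong assms derivable_holds[OF assms(1), of _ e]
  unfolding sufficiently_strong_def by (metis holds_Neg)

text \<open>Transfers the coding conditions, which speak of derivable numeral instances, to truth
  under an assignment.\<close>

lemma holds_app_iff_derivable:
  assumes "consistent_model B" "delta0_of_arity (length ts) \<phi>"
  shows "holds e (app \<phi> ts) \<longleftrightarrow> A \<turnstile> app \<phi> (map (\<lambda>t. num (tm_val e t)) ts)"
proof -
  let ?ns = "map (\<lambda>t. num (tm_val e t)) ts"
  have "delta0 (app \<phi> ?ns)"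
    using assms(2) by (simp add: app_def delta0_of_arity_def delta0_fsubst)
  moreover have "closed_fm (app \<phi> ?ns)"
    using assms(2) closed_tm_num
    by (auto simp: app_def delta0_of_arity_def closed_fm_def closed_tm_def ffv_fsubst)
  moreover have "holds e (app \<phi> ?ns) \<longleftrightarrow> holds e (app \<phi> ts)"
    unfolding holds_app by (rule arg_cong[where f = "\<lambda>e. holds e \<phi>"]) auto
  ultimately show ?thesis
    using delta0_holds_iff_derivable[OF assms(1)] by simp
qed

end


section \<open>Consistency\<close>

locale coded_arithmetic = strong_arithmetic +
  fixes K :: coding
  assumes coding: "coding_for A K"
begin

text \<open>\<open>A\<close> proves equations between identical numerals, so equal codes fall under
  the Comp condition.\<close>

lemma gn_inject: "gn K \<phi> = gn K \<psi> \<longleftrightarrow> \<phi> = \<psi>"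
  using coding strong
  by (auto simp: coding_for_def Comp_cond_def quote_def sufficiently_strong_def)

section \<open>Arithmetized derivations read in the standard model\<close>

context
  fixes B assumes model: "consistent_model B"
begin

lemma holds_Form: "holds e (app (Form K) [t]) \<longleftrightarrow> (\<exists>\<phi>. tm_val e t = gn K \<phi>)"
  using holds_app_iff_derivable[OF model, of "[t]" "Form K" e] coding
  by (simp add: coding_for_def well_formed_coding_def Rule_cond_def)

lemma holds_Ax: "holds e (app (Ax K) [t]) \<longleftrightarrow> (\<exists>\<phi>\<in>axioms A. tm_val e t = gn K \<phi>)"
  using holds_app_iff_derivable[OF model, of "[t]" "Ax K" e] coding
  by (simp add: coding_for_def well_formed_coding_def Rule_cond_def)

lemma holds_MP:
  "holds e (app (MP K) [s, t, u]) \<longleftrightarrow>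
    (\<exists>\<phi> \<psi>. tm_val e s = gn K \<phi> \<and> tm_val e t = gn K (Imp \<phi> \<psi>) \<and> tm_val e u = gn K \<psi>)"
  using holds_app_iff_derivable[OF model, of "[s, t, u]" "MP K" e] coding
  by (simp add: coding_for_def well_formed_coding_def Rule_cond_def numeral_3_eq_3)

lemma holds_Gen:
  "holds e (app (Gen K) [s, t]) \<longleftrightarrow>
    (\<exists>\<phi> x. tm_val e s = gn K \<phi> \<and> tm_val e t = gn K (all_var x \<phi>))"
  using holds_app_iff_derivable[OF model, of "[s, t]" "Gen K" e] coding
  by (simp add: coding_for_def well_formed_coding_def Rule_cond_def numeral_2_eq_2)

lemma holds_Seq:
  "holds e (app (Seq K) [s, t]) \<longleftrightarrow>
    (\<exists>xs. seq_of K (tm_val e s) = Some xs \<and> length xs = tm_val e t)"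
  using holds_app_iff_derivable[OF model, of "[s, t]" "Seq K" e] coding
  by (simp add: coding_for_def well_formed_coding_def Seq_cond_def numeral_2_eq_2)

text \<open>The coding conditions fix the meaning of \<open>Elt\<close> only at positions inside a
  coded sequence, whence the assumptions.\<close>

lemma holds_Elt:
  assumes "seq_of K (tm_val e s) = Some xs" "tm_val e t < length xs"
  shows "holds e (app (Elt K) [s, t, u]) \<longleftrightarrow> xs ! tm_val e t = tm_val e u"
  using holds_app_iff_derivable[OF model, of "[s, t, u]" "Elt K" e] coding assms
  by (simp add: coding_for_def well_formed_coding_def Seq_cond_def numeral_3_eq_3)

text \<open>This is the induction step for reading off a derivation: the disjuncts of
  \<open>Line\<close> match the rules of the calculus, and injectivity of \<open>gn\<close>
  identifies the formulas at cited positions with those known derivable.\<close>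

lemma Line_derivable:
  assumes "holds e (app (Line K) [s, t])"
    and xs: "seq_of K (tm_val e s) = Some xs" and i: "tm_val e t < length xs"
    and earlier: "\<And>j. j < tm_val e t \<Longrightarrow> \<exists>\<phi>. xs ! j = gn K \<phi> \<and> A \<turnstile> \<phi>"
  shows "\<exists>\<phi>. xs ! tm_val e t = gn K \<phi> \<and> A \<turnstile> \<phi>"
proof -
  let ?i = "tm_val e t"
  define d where "d = (\<lambda>k. if k < length [s, t] then tm_val e ([s, t] ! k) else e k)"
  have d [simp]: "d 0 = tm_val e s" "d (Suc 0) = tm_val e t"
    by (simp_all add: d_def)
  have "holds d (Line K)"
    using assms(1) unfolding d_def by (simp only: holds_app)
  \<comment> \<open>Cited positions lie below \<open>?i\<close> and so inside \<open>xs\<close>;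
    \<open>conj_cong\<close> makes this bound available to \<open>holds_Elt\<close>.\<close>
  then have "(\<exists>\<phi>\<in>axioms A. xs ! ?i = gn K \<phi>) \<or>
      (\<exists>j<?i. \<exists>k<?i. \<exists>\<phi> \<psi>. xs ! j = gn K \<phi> \<and> xs ! k = gn K (Imp \<phi> \<psi>) \<and> xs ! ?i = gn K \<psi>) \<or>
      (\<exists>j<?i. \<exists>\<phi> x. xs ! j = gn K \<phi> \<and> xs ! ?i = gn K (all_var x \<phi>))"
    using xs i
    by (simp add: Line_def Let_def holds_Form holds_Ax holds_MP holds_Gen holds_Elt cong: conj_cong)
      blast
  then consider (Ax) "\<exists>\<phi>\<in>axioms A. xs ! ?i = gn K \<phi>"
    | (MP) j k \<phi> \<psi> where "j < ?i" "k < ?i"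
        "xs ! j = gn K \<phi>" "xs ! k = gn K (Imp \<phi> \<psi>)" "xs ! ?i = gn K \<psi>"
    | (Gen) j \<phi> x where "j < ?i" "xs ! j = gn K \<phi>" "xs ! ?i = gn K (all_var x \<phi>)"
    by blast
  then show ?thesis
  proof cases
    case Ax
    then show ?thesis by (auto intro: derivable.ax)
  next
    case (MP j k \<phi> \<psi>)
    with earlier[of j] earlier[of k] have "A \<turnstile> \<phi>" "A \<turnstile> Imp \<phi> \<psi>"
      by (auto simp: gn_inject)
    then show ?thesis using MP(5) by (blast intro: derivable.mp)
  next
    case (Gen j \<phi> x)
    with earlier[of j] have "A \<turnstile> \<phi>" by (auto simp: gn_inject)
    then show ?thesis using Gen(3) by (blast intro: derivable.gen)
  qed
qed

lemma Prf_derivable: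
  assumes "holds e (app (Prf K) [s, t])" "tm_val e t = gn K \<phi>"
  shows "A \<turnstile> \<phi>"
proof -
  define d where "d = (\<lambda>k. if k < length [s, t] then tm_val e ([s, t] ! k) else e k)"
  have d [simp]: "d 0 = tm_val e s" "d (Suc 0) = tm_val e t"
    by (simp_all add: d_def)
  have "holds d (Prf K)"
    using assms(1) unfolding d_def by (simp only: holds_app)
  \<comment> \<open>The last entry sits at \<open>m\<close>, the predecessor of the length.\<close>
  then obtain xs m where xs: "seq_of K (tm_val e s) = Some xs" and m: "Suc m = length xs"
      and last: "holds (d(2 := length xs, 4 := m)) (app (Elt K) [Var 0, Var 4, Var 1])"
      and lines: "\<forall>i<length xs. holds (d(2 := length xs, 3 := i)) (app (Line K) [Var 0, Var 3])"
    by (auto simp: Prf_def Let_def holds_Seq)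
  \<comment> \<open>Complete induction on the position, since a line cites only earlier
    ones.\<close>
  have line: "\<exists>\<phi>. xs ! i = gn K \<phi> \<and> A \<turnstile> \<phi>" if "i < length xs" for i
    using that
  proof (induction i rule: less_induct)
    case (less i)
    with lines have "holds (d(2 := length xs, 3 := i)) (app (Line K) [Var 0, Var 3])" by blast
    from Line_derivable[OF this] less xs show ?case by simp
  qed
  have "xs ! m = gn K \<phi>"
    using last m xs assms(2) by (simp add: holds_Elt)
  with line[of m] m show ?thesis by (auto simp: gn_inject)
qed

lemma holds_Con:
  assumes "\<not> A \<turnstile> Bot"
  shows "holds e (Con K)"
proof (rule ccontr)
  assume "\<not> holds e (Con K)"
  then have "holds e (app (Prov K) [quote K Bot])"
    by (simp add: Con_def)
  define d where "d = (\<lambda>k. if k < length [quote K Bot] then tm_val e ([quote K Bot] ! k) else e k)"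
  from \<open>holds e (app (Prov K) [quote K Bot])\<close> have "holds d (Prov K)"
    unfolding d_def by (simp only: holds_app)
  \<comment> \<open>Truth in the standard model makes the witness a genuine natural number, so it
    codes an actual finite derivation.\<close>
  then obtain p where "holds (d(1 := p)) (app (Prf K) [Var 1, Var 0])"
    unfolding Prov_def holds_ex_var by blast
  from Prf_derivable[OF this, of Bot] assms show False by (simp add: quote_def d_def)
qed

end

section \<open>Closedness of the consistency statement\<close>

lemma ffv_Con_components:
  "ffv (app (Form K) [t]) \<subseteq> tfv t"
  "ffv (app (Ax K) [t]) \<subseteq> tfv t"
  "ffv (app (Seq K) [s, t]) \<subseteq> tfv s \<union> tfv t"
  "ffv (app (Gen K) [s, t]) \<subseteq> tfv s \<union> tfv t"
  "ffv (app (Elt K) [s, t, u]) \<subseteq> tfv s \<union> tfv t \<union> tfv u"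
  "ffv (app (MP K) [s, t, u]) \<subseteq> tfv s \<union> tfv t \<union> tfv u"
  "tfv (Bnd K) \<subseteq> {0}"
  using coding ffv_app_subset[of "Form K" "[t]"] ffv_app_subset[of "Ax K" "[t]"]
    ffv_app_subset[of "Seq K" "[s, t]"] ffv_app_subset[of "Gen K" "[s, t]"]
    ffv_app_subset[of "Elt K" "[s, t, u]"] ffv_app_subset[of "MP K" "[s, t, u]"]
  by (simp_all add: coding_for_def well_formed_coding_def delta0_of_arity_def
      numeral_2_eq_2 numeral_3_eq_3 Un_assoc)

lemma ffv_Line: "ffv (Line K) \<subseteq> {0, 1}"
  unfolding Line_def Let_def by (auto dest!: ffv_Con_components[THEN subsetD])

lemma ffv_Prf: "ffv (Prf K) \<subseteq> {0, 1}"
proof -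
  have "ffv (app (Line K) [Var 0, Var 3]) \<subseteq> {0, 3}"
    using ffv_app_subset[of "Line K" "[Var 0, Var 3]"] ffv_Line by auto
  then show ?thesis
    unfolding Prf_def Let_def by (auto dest!: ffv_Con_components[THEN subsetD])
qed

lemma ffv_Prov: "ffv (Prov K) \<subseteq> {0}"
  using ffv_app_subset[of "Prf K" "[Var 1, Var 0]"] ffv_Prf
  unfolding Prov_def by auto

text \<open>Being closed, \<open>Con K\<close> equals each of its instances, so results about
  \<open>fsubst \<sigma>\<close> apply to it directly.\<close>

lemma closed_Con: "closed_fm (Con K)"
  using ffv_app_subset[of "Prov K" "[quote K Bot]"] ffv_Prov closed_tm_num
  by (auto simp: closed_fm_def closed_tm_def Con_def Neg_def quote_def)

end

theorem corollary16:
  fixes A :: "fm set" and K :: coding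
  assumes "arithmetic_theory A"
    and "coding_for A K"
    and "recursively_axiomatizable (gn K) A"
    and "sufficiently_strong A"
  shows "A \<tturnstile> Con K"
proof -
  interpret coded_arithmetic A K
    using assms by unfold_locales
  have "supports B (Con K)" if B: "base B" "\<forall>\<phi>\<in>A. supports B \<phi>" for B
  \<comment> \<open>Consistency of \<open>A\<close> is not presupposed: if \<open>A\<close> is
    inconsistent, every base supporting it falls under the first case.\<close>
  proof (cases "supports B Bot")
    case True
    then show ?thesis
      using supports_ex_falso[OF True closing_num[of "\<lambda>_. 0"], of "Con K"]
      by (simp add: fsubst_closed[OF closed_Con])
  next
    case False
    with B have model: "consistent_model B" by (simp add: consistent_model_def)
    \<comment> \<open>By soundness, a derivation of \<open>Bot\<close> from \<open>A\<close> would
      make \<open>B\<close> support \<open>Bot\<close>.\<close>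
    then have "\<not> A \<turnstile> Bot"
      using model_derivable[OF model _ closing_num, of Bot] False by auto
    then show ?thesis
      using holds_Con[OF model]
        model_supports_iff_holds[OF model closing_num[of "\<lambda>_. 0"], of "Con K"]
      by (simp add: fsubst_closed[OF closed_Con])
  qed
  then show ?thesis
    by (simp add: valid_def supports_from_def)
qed

end
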